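(* Let $X:\Phi'\to\Phi'$ be a Borel vector field and $\beta>0$. Any $(\beta,X)$-KMS state $\mu$ on $\Phi'$ is a stationary solution of the Liouville equation, i.e. for all $F\in\mathscr{C}^\infty_{c,cyl}(\Phi')$ the function $\langle\nabla F(\cdot),X(\cdot)\rangle$ is $\mu$-integrable and $$\int_{\Phi'}\langle\nabla F(u),X(u)\rangle\,d\mu=0.$$
   Context: $H$ is a real separable Hilbert space with inner product $\langle\cdot,\cdot\rangle$; $\Phi\subseteq H$ is a dense subspace equipped with a topological vector space structure such that the embedding $\Phi\to H$ is continuous; $\Phi'$ is the dual of $\Phi$ with respect to the inner product of $H$, so $\Phi\subseteq H\subseteq\Phi'$ and $\langle\cdot,\cdot\rangle$ also denotes the duality pairing. $\Phi'$ carries the weak-$*$ topology and its Borel $\sigma$-algebra. $\sigma:H\times H\to\mathbb{R}$ is a continuous antisymmetric non-degenerate bilinear form and $J:H\to H$ is the bounded operator with $\sigma(u,v)=\langle u,Jv\rangle$ (so $J^T=-J$); $J$ maps $\Phi$ continuously to itself, hence extends to $\Phi'$. $\{e_n\}_{n\in\mathbb{N}}$ is a countable linearly independent subset of $\Phi$ such that $\mathrm{span}_{\mathbb{R}}\{e_j\}$ is dense in $H$. $\mathscr{C}^\infty_{c,cyl}(\Phi')$ is the set of $F:\Phi'\to\mathbb{R}$ of the form $F(u)=\varphi(\langle u,e_1\rangle,\dots,\langle u,e_n\rangle)$ with $n\in\mathbb{N}$, $\varphi\in\mathscr{C}_c^\infty(\mathbb{R}^n)$. The gradient is $\nabla F(u)=\sum_{j=1}^n\partial_j\varphi(\langle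 u,e_1\rangle,\dots,\langle u,e_n\rangle)\,e_j\in\Phi$ and the Poisson bracket is $\{F,G\}(u)=\langle\nabla F(u),J\nabla G(u)\rangle$. A Borel probability measure $\mu$ on $\Phi'$ is a $(\beta,X)$-KMS state if $\langle f,X(\cdot)\rangle$ is $\mu$-integrable for all $f\in\Phi$ and, for all $F,G\in\mathscr{C}^\infty_{c,cyl}(\Phi')$, $\int_{\Phi'}\{F,G\}(u)\,d\mu=\beta\int_{\Phi'}\langle\nabla F(u),X(u)\rangle\,G(u)\,d\mu$. *)

theory Defs
  imports "HOL-Probability.Probability"
begin

text \<open>
  The dense subspace \<open>\<Phi>\<close> of \<open>H\<close> carries a topology of its own, given as an abstract topology \<open>T\<close>
  with \<open>topspace T = \<Phi>\<close>.
\<close>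

definition topological_vector_subspace :: "'h::real_vector topology \<Rightarrow> bool" where
  "topological_vector_subspace T \<longleftrightarrow>
     subspace (topspace T) \<and>
     continuous_map (prod_topology T T) T (\<lambda>(x, y). x + y) \<and>
     continuous_map (prod_topology euclideanreal T) T (\<lambda>(c, x). c *\<^sub>R x)"

text \<open>
  Elements of \<open>\<Phi>'\<close> are represented as functions that are \<open>undefined\<close> outside \<open>\<Phi>\<close>, so that equality in
  \<open>\<Phi>'\<close> is equality of functions; \<open>u f\<close> is the duality pairing of \<open>u \<in> \<Phi>'\<close> and \<open>f \<in> \<Phi>\<close>. A vector
  \<open>h\<close> of \<open>H\<close> is identified with \<open>\<lambda>f\<in>\<Phi>. h \<bullet> f\<close> (see \<open>dual_embed\<close> below).
\<close>

definition dual :: "'h::real_vector topology \<Rightarrow> ('h \<Rightarrow> real) set" where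
  "dual T = {u \<in> extensional (topspace T).
     (\<forall>f\<in>topspace T. \<forall>g\<in>topspace T. u (f + g) = u f + u g) \<and>
     (\<forall>c. \<forall>f\<in>topspace T. u (c *\<^sub>R f) = c * u f) \<and>
     continuous_map T euclideanreal u}"

definition weak_star_topology :: "'h::real_vector topology \<Rightarrow> ('h \<Rightarrow> real) topology" where
  "weak_star_topology T =
     subtopology (product_topology (\<lambda>_. euclideanreal) (topspace T)) (dual T)"

definition borel_dual :: "'h::real_vector topology \<Rightarrow> ('h \<Rightarrow> real) measure" where
  "borel_dual T = sigma (dual T) {U. openin (weak_star_topology T) U}"

definition dual_embed :: "'h::real_inner topology \<Rightarrow> 'h \<Rightarrow> 'h \<Rightarrow> real" where
  "dual_embed T h = (\<lambda>f\<in>topspace T. h \<bullet> f)"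

text \<open>
  A real separable Hilbert space is a type of sort \<open>{real_inner, polish_space}\<close>. The family
  \<open>e\<close> is indexed from 0.
\<close>

locale hamiltonian_setting =
  fixes T :: "'h::{real_inner, polish_space} topology"
    and \<sigma> :: "'h \<Rightarrow> 'h \<Rightarrow> real"
    and J :: "'h \<Rightarrow> 'h"
    and e :: "nat \<Rightarrow> 'h"
  assumes tvs: "topological_vector_subspace T"
    and dense: "closure (topspace T) = UNIV"
    and embedding_continuous: "continuous_map T euclidean (\<lambda>f. f)"
    and \<sigma>_bilinear: "bounded_bilinear \<sigma>"
    and \<sigma>_antisym: "\<And>u v. \<sigma> u v = - \<sigma> v u"
    and \<sigma>_nondegenerate: "\<And>u. (\<forall>v. \<sigma> u v = 0) \<Longrightarrow> u = 0"
    and J_bounded: "bounded_linear J"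
    and \<sigma>_J: "\<And>u v. \<sigma> u v = u \<bullet> J v"
    and J_continuous: "continuous_map T T J"
    and e_in: "range e \<subseteq> topspace T"
    and e_inj: "inj e"
    and e_independent: "independent (range e)"
    and e_dense: "closure (span (range e)) = UNIV"

text \<open>
  Points of the n-dimensional space are sequences vanishing from index n on
  (\<^const>\<open>Euclidean_space\<close>); only the values of a function at such points matter.
\<close>

definition partial_deriv :: "nat \<Rightarrow> ((nat \<Rightarrow> real) \<Rightarrow> real) \<Rightarrow> (nat \<Rightarrow> real) \<Rightarrow> real" where
  "partial_deriv i \<phi> x = deriv (\<lambda>t. \<phi> (x(i := t))) (x i)"

primrec C_k :: "nat \<Rightarrow> nat \<Rightarrow> ((nat \<Rightarrow> real) \<Rightarrow> real) \<Rightarrow> bool" where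
  "C_k n 0 \<phi> \<longleftrightarrow> continuous_map (Euclidean_space n) euclideanreal \<phi>"
| "C_k n (Suc k) \<phi> \<longleftrightarrow>
     continuous_map (Euclidean_space n) euclideanreal \<phi> \<and>
     (\<forall>i<n. (\<forall>x\<in>topspace (Euclidean_space n).
               (\<lambda>t. \<phi> (x(i := t))) differentiable at (x i)) \<and>
            C_k n k (partial_deriv i \<phi>))"

definition test_functions :: "nat \<Rightarrow> ((nat \<Rightarrow> real) \<Rightarrow> real) set" where
  "test_functions n = {\<phi>. (\<forall>k. C_k n k \<phi>) \<and>
     compactin (Euclidean_space n)
       (Euclidean_space n closure_of {x \<in> topspace (Euclidean_space n). \<phi> x \<noteq> 0})}"

definition coords :: "(nat \<Rightarrow> 'h) \<Rightarrow> nat \<Rightarrow> ('h \<Rightarrow> real) \<Rightarrow> nat \<Rightarrow> real" where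
  "coords e n u = (\<lambda>j. if j < n then u (e j) else 0)"

text \<open>
  The number n of coordinates is positive: for n = 0 one would obtain the nonzero constants, which
  are not compactly supported functions of any positive number of coordinates.
\<close>

definition represents ::
  "'h::real_vector topology \<Rightarrow> (nat \<Rightarrow> 'h) \<Rightarrow> nat \<Rightarrow> ((nat \<Rightarrow> real) \<Rightarrow> real) \<Rightarrow>
     (('h \<Rightarrow> real) \<Rightarrow> real) \<Rightarrow> bool" where
  "represents T e n \<phi> F \<longleftrightarrow>
     n \<ge> 1 \<and> \<phi> \<in> test_functions n \<and> (\<forall>u\<in>dual T. F u = \<phi> (coords e n u))"

definition cyl_functions ::
  "'h::real_vector topology \<Rightarrow> (nat \<Rightarrow> 'h) \<Rightarrow> (('h \<Rightarrow> real) \<Rightarrow> real) set" where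
  "cyl_functions T e = {F. \<exists>n \<phi>. represents T e n \<phi> F}"

text \<open>
  The gradient is independent of the representation of \<open>F\<close>, so that it is given by the formula
  below for every representation: lemma \<open>gradient_eq\<close>.
\<close>

definition gradient ::
  "'h::real_vector topology \<Rightarrow> (nat \<Rightarrow> 'h) \<Rightarrow> (('h \<Rightarrow> real) \<Rightarrow> real) \<Rightarrow> ('h \<Rightarrow> real) \<Rightarrow> 'h" where
  "gradient T e F u =
     (THE v. \<exists>n \<phi>. represents T e n \<phi> F \<and>
               v = (\<Sum>j<n. partial_deriv j \<phi> (coords e n u) *\<^sub>R e j))"

definition poisson_bracket ::
  "'h::real_inner topology \<Rightarrow> ('h \<Rightarrow> 'h) \<Rightarrow> (nat \<Rightarrow> 'h) \<Rightarrow>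
     (('h \<Rightarrow> real) \<Rightarrow> real) \<Rightarrow> (('h \<Rightarrow> real) \<Rightarrow> real) \<Rightarrow> ('h \<Rightarrow> real) \<Rightarrow> real" where
  "poisson_bracket T J e F G u = gradient T e F u \<bullet> J (gradient T e G u)"

definition KMS_state ::
  "'h::real_inner topology \<Rightarrow> ('h \<Rightarrow> 'h) \<Rightarrow> (nat \<Rightarrow> 'h) \<Rightarrow> real \<Rightarrow>
     (('h \<Rightarrow> real) \<Rightarrow> ('h \<Rightarrow> real)) \<Rightarrow> ('h \<Rightarrow> real) measure \<Rightarrow> bool" where
  "KMS_state T J e \<beta> X \<mu> \<longleftrightarrow>
     sets \<mu> = sets (borel_dual T) \<and> prob_space \<mu> \<and>
     (\<forall>f\<in>topspace T. integrable \<mu> (\<lambda>u. X u f)) \<and>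
     (\<forall>F\<in>cyl_functions T e. \<forall>G\<in>cyl_functions T e.
        (\<integral>u. poisson_bracket T J e F G u \<partial>\<mu>) = \<beta> * (\<integral>u. X u (gradient T e F u) * G u \<partial>\<mu>))"

lemma space_borel_dual: "space (borel_dual T) = dual T"
  unfolding borel_dual_def by (simp add: space_measure_of_conv)

lemma exists_orthogonal_projection:
  fixes S :: "'a::real_inner set"
  assumes "finite S"
  shows "\<exists>p\<in>span S. \<forall>s\<in>S. (v - p) \<bullet> s = 0"
  using assms
proof (induction S arbitrary: v)
  case empty
  then show ?case by (auto simp: span_zero)
next
  case (insert a S)
  obtain q where q: "q \<in> span S" "\<forall>s\<in>S. (a - q) \<bullet> s = 0"
    using insert.IH[of a] by blast
  obtain r where r: "r \<in> span S" "\<forall>s\<in>S. (v - r) \<bullet> s = 0"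
    using insert.IH[of v] by blast
  define b where "b = a - q"
  define c where "c = ((v - r) \<bullet> b) / (b \<bullet> b)"
  have S_sub: "span S \<subseteq> span (insert a S)"
    by (rule span_mono) auto
  have b_in: "b \<in> span (insert a S)"
    unfolding b_def using q(1) S_sub by (intro span_diff) (auto intro: span_base)
  have b_orth: "b \<bullet> s = 0" if "s \<in> S" for s
    using q(2) that by (simp add: b_def)
  have orth_S: "(v - (r + c *\<^sub>R b)) \<bullet> s = 0" if "s \<in> S" for s
    using r(2) b_orth that by (simp add: inner_diff_left inner_add_left)
  have "orthogonal (v - (r + c *\<^sub>R b)) q"
    using orth_S q(1) by (intro orthogonal_to_span[of q S]) (auto simp: orthogonal_def)
  moreover have "(v - (r + c *\<^sub>R b)) \<bullet> b = 0"
    by (cases "b = 0") (simp_all add: c_def inner_diff_left inner_add_left)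
  moreover have "a = b + q" by (simp add: b_def)
  ultimately have "(v - (r + c *\<^sub>R b)) \<bullet> a = 0"
    by (simp only: inner_add_right orthogonal_def)
  moreover have "r + c *\<^sub>R b \<in> span (insert a S)"
    using r(1) S_sub b_in by (intro span_add span_scale) auto
  ultimately show ?case using orth_S by blast
qed

context hamiltonian_setting
begin

lemma exists_dual_vector:
  shows "\<exists>h. \<forall>j<N. h \<bullet> e j = (if j = i then 1 else 0)"
proof -
  define S where "S = e ` ({..<N} - {i})"
  obtain p where p: "p \<in> span S" "\<forall>s\<in>S. (e i - p) \<bullet> s = 0"
    using exists_orthogonal_projection[of S "e i"] by (auto simp: S_def)
  define w where "w = e i - p"
  have "S \<subseteq> range e - {e i}"
    using e_inj by (auto simp: S_def inj_eq)
  hence "e i \<notin> span S"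
    using e_independent span_mono[of S "range e - {e i}"] by (auto simp: dependent_def)
  hence w0: "w \<noteq> 0" using p(1) by (auto simp: w_def)
  have "orthogonal w p"
    using p by (intro orthogonal_to_span[of p S]) (auto simp: orthogonal_def w_def)
  moreover have "e i = w + p" by (simp add: w_def)
  ultimately have "w \<bullet> e i = w \<bullet> w"
    by (simp add: inner_add_right orthogonal_def)
  moreover have "w \<bullet> e j = 0" if "j < N" "j \<noteq> i" for j
    using p(2) that by (auto simp: S_def w_def)
  ultimately have "\<forall>j<N. (w /\<^sub>R (w \<bullet> w)) \<bullet> e j = (if j = i then 1 else 0)"
    using w0 by auto
  then show ?thesis by blast
qed

lemma subspace_\<Phi>: "subspace (topspace T)"
  using tvs by (simp add: topological_vector_subspace_def)

lemma continuous_map_inner_left: "continuous_map T euclideanreal (\<lambda>f. h \<bullet> f)"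
proof -
  have "continuous_map euclidean euclideanreal (\<lambda>f. h \<bullet> f)"
    by (simp add: continuous_on_inner)
  from continuous_map_compose[OF embedding_continuous this] show ?thesis
    by (simp add: o_def)
qed

lemma dual_add_embed:
  assumes "u \<in> dual T"
  shows "(\<lambda>f\<in>topspace T. u f + t * (h \<bullet> f)) \<in> dual T"
proof -
  have "continuous_map T euclideanreal (\<lambda>f. u f + t * (h \<bullet> f))"
    using assms continuous_map_inner_left[of h]
    by (intro continuous_map_add continuous_map_real_mult) (auto simp: dual_def)
  hence "continuous_map T euclideanreal (\<lambda>f\<in>topspace T. u f + t * (h \<bullet> f))"
    by (rule continuous_map_eq) simp
  then show ?thesis
    using assms subspace_\<Phi>
    by (auto simp: dual_def subspace_add subspace_scale inner_add_right algebra_simps)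
qed

lemma dual_embed_in_dual: "dual_embed T h \<in> dual T"
proof -
  have "continuous_map T euclideanreal (dual_embed T h)"
    unfolding dual_embed_def by (rule continuous_map_eq[OF continuous_map_inner_left[of h]]) simp
  then show ?thesis
    using subspace_\<Phi>
    by (auto simp: dual_def dual_embed_def subspace_add subspace_scale inner_add_right)
qed

lemma partial_deriv_eq_directional:
  assumes rep: "represents T e n \<phi> F" and u: "u \<in> dual T"
    and h: "\<forall>j<N. h \<bullet> e j = (if j = i then 1 else 0)" and "n \<le> N"
  shows "deriv (\<lambda>t. F (\<lambda>f\<in>topspace T. u f + (t - u (e i)) * (h \<bullet> f))) (u (e i))
       = (if i < n then partial_deriv i \<phi> (coords e n u) else 0)"
proof -
  have e: "e j \<in> topspace T" for j using e_in by auto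
  have "coords e n (\<lambda>f\<in>topspace T. u f + (t - u (e i)) * (h \<bullet> f))
      = (if i < n then (coords e n u)(i := t) else coords e n u)" for t
    using h \<open>n \<le> N\<close> by (auto simp: coords_def fun_eq_iff e)
  then show ?thesis
    using rep dual_add_embed[OF u] by (simp add: represents_def partial_deriv_def coords_def)
qed

lemma gradient_unique:
  assumes 1: "represents T e n \<phi> F" and 2: "represents T e m \<psi> F" and u: "u \<in> dual T"
  shows "(\<Sum>j<n. partial_deriv j \<phi> (coords e n u) *\<^sub>R e j)
       = (\<Sum>j<m. partial_deriv j \<psi> (coords e m u) *\<^sub>R e j)"
proof -
  define N where "N = max n m"
  have ext: "(\<Sum>j<k. a j *\<^sub>R e j) = (\<Sum>j<N. (if j < k then a j else 0) *\<^sub>R e j)"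
    if "k \<le> N" for k and a :: "nat \<Rightarrow> real"
    using that by (intro sum.mono_neutral_cong_left) auto
  have "(if j < n then partial_deriv j \<phi> (coords e n u) else 0)
      = (if j < m then partial_deriv j \<psi> (coords e m u) else 0)" for j
  proof -
    obtain h where h: "\<forall>k<N. h \<bullet> e k = (if k = j then 1 else 0)"
      using exists_dual_vector by blast
    show ?thesis
      using partial_deriv_eq_directional[OF 1 u h] partial_deriv_eq_directional[OF 2 u h]
      by (simp add: N_def)
  qed
  then show ?thesis
    by (subst (1 2) ext) (simp_all add: N_def)
qed

lemma gradient_eq:
  assumes "represents T e n \<phi> F" "u \<in> dual T"
  shows "gradient T e F u = (\<Sum>j<n. partial_deriv j \<phi> (coords e n u) *\<^sub>R e j)"
  unfolding gradient_def
proof (rule the_equality)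
  show "\<exists>k \<psi>. represents T e k \<psi> F \<and>
          (\<Sum>j<n. partial_deriv j \<phi> (coords e n u) *\<^sub>R e j)
            = (\<Sum>j<k. partial_deriv j \<psi> (coords e k u) *\<^sub>R e j)"
    using assms by blast
qed (use assms gradient_unique in blast)

lemma gradient_in:
  assumes "F \<in> cyl_functions T e" "u \<in> dual T"
  shows "gradient T e F u \<in> topspace T"
proof -
  obtain n \<phi> where "represents T e n \<phi> F"
    using assms by (auto simp: cyl_functions_def)
  then show ?thesis
    using gradient_eq[OF _ assms(2)] e_in subspace_\<Phi>
    by (auto intro!: subspace_sum subspace_scale)
qed

end

end

theory Submission
  imports Defs
begin

text \<open>
  If \<open>F\<close> depends on \<open>n\<close> coordinates through \<open>\<phi>\<close>, choose \<open>G\<close> depending on the same coordinates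
  through a smooth cutoff function that is 1 on a neighbourhood of the support of \<open>\<phi>\<close>. Then
  \<open>\<nabla>F\<close> or \<open>\<nabla>G\<close> vanishes at each point, so \<open>{F, G} = 0\<close>, whereas \<open>\<langle>\<nabla>F, X\<rangle> G = \<langle>\<nabla>F, X\<rangle>\<close>. The
  KMS condition for this single pair gives the claim.
\<close>

section \<open>Smooth cutoff functions of one variable\<close>

text \<open>Level 0 demands nothing, not even continuity, so the inductions below start trivially.
  Smoothness is the predicate at every level; continuity is recovered from any level
  \<open>Suc k\<close>.\<close>

primrec differentiable_upto :: "nat \<Rightarrow> (real \<Rightarrow> real) \<Rightarrow> bool" where
  "differentiable_upto 0 f \<longleftrightarrow> True"
| "differentiable_upto (Suc k) f \<longleftrightarrow>
     (\<forall>x. f differentiable at x) \<and> differentiable_upto k (deriv f)"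

text \<open>Allows the derivative to be given by an explicit formula instead of
  \<open>deriv f\<close>.\<close>

lemma differentiable_upto_SucI:
  assumes "\<And>x. (f has_real_derivative f' x) (at x)" "differentiable_upto k f'"
  shows "differentiable_upto (Suc k) f"
proof -
  have "deriv f = f'"
    using assms(1) by (auto intro: DERIV_imp_deriv)
  then show ?thesis
    using assms by (auto simp: real_differentiable_def)
qed

lemma differentiable_upto_SucD:
  assumes "differentiable_upto (Suc k) f"
  shows "(f has_real_derivative deriv f x) (at x)" "differentiable_upto k (deriv f)"
  using assms by (auto simp: DERIV_deriv_iff_real_differentiable)

lemma differentiable_upto_Suc_imp: "differentiable_upto (Suc k) f \<Longrightarrow> differentiable_upto k f"
  by (induction k arbitrary: f) auto

section \<open>Closure properties of iterated differentiability\<close>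

lemma differentiable_upto_const: "differentiable_upto k (\<lambda>_. c)"
proof (induction k arbitrary: c)
  case (Suc k)
  show ?case
    by (rule differentiable_upto_SucI[where f' = "\<lambda>_. 0"]) (auto simp: Suc)
qed auto

lemma differentiable_upto_ident: "differentiable_upto k (\<lambda>x. x)"
proof (cases k)
  case (Suc k')
  show ?thesis unfolding Suc
    by (rule differentiable_upto_SucI[where f' = "\<lambda>_. 1"])
       (auto simp: differentiable_upto_const)
qed auto

lemma differentiable_upto_add:
  assumes "differentiable_upto k f" "differentiable_upto k g"
  shows "differentiable_upto k (\<lambda>x. f x + g x)"
  using assms
proof (induction k arbitrary: f g)
  case (Suc k)
  show ?case
    by (rule differentiable_upto_SucI[where f' = "\<lambda>x. deriv f x + deriv g x"])
       (auto intro!: DERIV_add differentiable_upto_SucD Suc)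
qed auto

lemma differentiable_upto_mult:
  assumes "differentiable_upto k f" "differentiable_upto k g"
  shows "differentiable_upto k (\<lambda>x. f x * g x)"
  using assms
proof (induction k arbitrary: f g)
  case (Suc k)
  show ?case
    by (rule differentiable_upto_SucI[where f' = "\<lambda>x. deriv f x * g x + deriv g x * f x"])
       (auto intro!: DERIV_mult differentiable_upto_add differentiable_upto_SucD Suc
          intro: differentiable_upto_Suc_imp Suc.prems)
qed auto

lemma differentiable_upto_compose:
  assumes "differentiable_upto k f" "differentiable_upto k g"
  shows "differentiable_upto k (\<lambda>x. f (g x))"
  using assms
proof (induction k arbitrary: f g)
  case (Suc k)
  show ?case
  proof (rule differentiable_upto_SucI)
    show "((\<lambda>x. f (g x)) has_real_derivative deriv f (g x) * deriv g x) (at x)" for x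
      by (rule DERIV_chain2[OF Suc.prems[THEN differentiable_upto_SucD(1)]])
    show "differentiable_upto k (\<lambda>x. deriv f (g x) * deriv g x)"
      by (rule differentiable_upto_mult[OF Suc.IH])
         (fact Suc.prems[THEN differentiable_upto_SucD(2)]
            differentiable_upto_Suc_imp[OF Suc.prems(2)])+
  qed
qed auto

lemma differentiable_upto_inverse:
  assumes "differentiable_upto k f" "\<And>x. f x \<noteq> 0"
  shows "differentiable_upto k (\<lambda>x. inverse (f x))"
  using assms
proof (induction k arbitrary: f)
  case (Suc k)
  have "differentiable_upto k (\<lambda>x. inverse (f x))"
    using Suc differentiable_upto_Suc_imp by blast
  \<comment> \<open>This is the derivative as \<open>DERIV_inverse'\<close> gives it, with the sign
    as a factor -1; the induction hypothesis for \<open>f\<close> itself covers both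
    reciprocals.\<close>
  hence "differentiable_upto k (\<lambda>x. (-1) * ((inverse (f x) * deriv f x) * inverse (f x)))"
    using differentiable_upto_SucD(2)[OF Suc.prems(1)]
    by (intro differentiable_upto_mult differentiable_upto_const)
  then show ?case
    using Suc.prems
    by (intro differentiable_upto_SucI[where
          f' = "\<lambda>x. (-1) * ((inverse (f x) * deriv f x) * inverse (f x))"])
       (auto intro!: DERIV_inverse' differentiable_upto_SucD(1)[of k]
          simp del: differentiable_upto.simps)
qed auto

section \<open>Functions flat at the origin\<close>

text \<open>
  The polynomial factor makes this family of flat functions closed under differentiation.
\<close>

definition flat :: "real poly \<Rightarrow> real \<Rightarrow> real" where
  "flat p x = (if x > 0 then poly p (inverse x) * exp (- inverse x) else 0)"

text \<open>Read with y = 1/x, this is the decay of \<open>flat p\<close> as x tends to 0 from the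
  right: the exponential beats every monomial.\<close>

lemma tendsto_poly_times_exp_minus: "((\<lambda>y. poly p y * exp (- y)) \<longlongrightarrow> (0::real)) at_top"
proof -
  have "((\<lambda>y. \<Sum>i\<le>degree p. coeff p i * (y ^ i / exp y)) \<longlongrightarrow> (\<Sum>i\<le>degree p. coeff p i * 0)) at_top"
    by (intro tendsto_intros tendsto_power_div_exp_0)
  then show ?thesis
    by (simp add: poly_altdef exp_minus field_simps sum_distrib_left sum_divide_distrib)
qed

text \<open>With y = 1/x one has dy/dx = -y^2, so p(y) exp(-y) has derivative y^2 (p - p')(y)
  exp(-y); \<open>[:0, 0, 1:]\<close> is the polynomial y^2. At 0 both one-sided difference
  quotients tend to 0.\<close>

lemma has_real_derivative_flat:
  "(flat p has_real_derivative flat ([:0, 0, 1:] * (p - pderiv p)) x) (at x)"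
proof -
  consider "x > 0" | "x < 0" | "x = 0" by linarith
  then show ?thesis
  proof cases
    case 1
    let ?f = "\<lambda>x. poly p (inverse x) * exp (- inverse x)"
    have "(?f has_real_derivative flat ([:0, 0, 1:] * (p - pderiv p)) x) (at x)"
      using 1
      by (auto intro!: derivative_eq_intros DERIV_chain2[OF poly_DERIV]
            simp: flat_def algebra_simps power2_eq_square)
    then show ?thesis
      by (rule has_field_derivative_transform_within_open[where S = "{0<..}"])
         (use 1 in \<open>auto simp: flat_def\<close>)
  next
    case 2
    have "((\<lambda>_. 0) has_real_derivative flat ([:0, 0, 1:] * (p - pderiv p)) x) (at x)"
      using 2 by (simp add: flat_def)
    then show ?thesis
      by (rule has_field_derivative_transform_within_open[where S = "{..<0}"])
         (use 2 in \<open>auto simp: flat_def\<close>)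
  next
    case 3
    \<comment> \<open>The division by \<open>h\<close> in the difference quotient is a factor y,
      absorbed into the polynomial as \<open>[:0, 1:] * p\<close>.\<close>
    have "((\<lambda>h. poly ([:0, 1:] * p) (inverse h) * exp (- inverse h)) \<longlongrightarrow> 0) (at_right 0)"
      by (rule filterlim_compose[OF tendsto_poly_times_exp_minus filterlim_inverse_at_top_right])
    moreover have "\<forall>\<^sub>F h in at_right 0.
        poly ([:0, 1:] * p) (inverse h) * exp (- inverse h) = flat p h / h"
      by (auto simp: eventually_at_right_less flat_def divide_inverse
            intro!: eventually_mono[OF eventually_at_right_less[of 0]])
    ultimately have right: "((\<lambda>h. flat p h / h) \<longlongrightarrow> 0) (at_right 0)"
      by (rule Lim_transform_eventually)
    have "\<forall>\<^sub>F h in at_left 0. 0 = flat p h / h"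
      by (auto simp: flat_def eventually_at_filter)
    hence "((\<lambda>h. flat p h / h) \<longlongrightarrow> 0) (at_left 0)"
      by (rule Lim_transform_eventually[OF tendsto_const])
    with right have "((\<lambda>h. flat p h / h) \<longlongrightarrow> 0) (at 0)"
      by (simp add: filterlim_split_at)
    then show ?thesis
      using 3 by (simp add: DERIV_def flat_def)
  qed
qed

lemma differentiable_upto_flat: "differentiable_upto k (flat p)"
proof (induction k arbitrary: p)
  case (Suc k)
  show ?case
    by (rule differentiable_upto_SucI[OF has_real_derivative_flat Suc])
qed auto

text \<open>The classical quotient g(x) / (g(x) + g(1 - x)) with g = \<open>flat 1\<close>, spelled
  out so that the closure lemmas for sums, products and reciprocals apply.\<close>

definition smooth_step :: "real \<Rightarrow> real" where
  "smooth_step x = flat 1 x * inverse (flat 1 x + flat 1 (1 + (-1) * x))"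

lemma differentiable_upto_smooth_step: "differentiable_upto k smooth_step"
proof -
  \<comment> \<open>The denominator is positive because x and 1 - x are never both
    nonpositive.\<close>
  have "flat 1 x + flat 1 (1 + (-1) * x) \<noteq> 0" for x
  proof -
    have "flat 1 y \<ge> 0" "y > 0 \<Longrightarrow> flat 1 y > 0" for y
      by (auto simp: flat_def)
    moreover have "x > 0 \<or> 1 + (-1) * x > 0" by auto
    ultimately show ?thesis
      by (metis add_nonneg_pos add_pos_nonneg less_irrefl)
  qed
  then show ?thesis
    unfolding smooth_step_def
    by (intro differentiable_upto_mult differentiable_upto_inverse differentiable_upto_add
          differentiable_upto_flat differentiable_upto_compose[OF differentiable_upto_flat]
          differentiable_upto_const differentiable_upto_ident)
qed

lemma smooth_step_eq_0: "x \<le> 0 \<Longrightarrow> smooth_step x = 0"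
  by (simp add: smooth_step_def flat_def)

lemma smooth_step_eq_1: "x \<ge> 1 \<Longrightarrow> smooth_step x = 1"
  by (simp add: smooth_step_def flat_def)

lemma exists_smooth_cutoff:
  fixes r :: real
  obtains b :: "real \<Rightarrow> real" and s where
    "\<And>k. differentiable_upto k b" "\<And>x. \<bar>x\<bar> < r \<Longrightarrow> b x = 1" "\<And>x. \<bar>x\<bar> > s \<Longrightarrow> b x = 0"
proof
  \<comment> \<open>Using x^2 in place of |x| keeps the function smooth at 0. The argument is at
    least 1 for |x| < r and at most 0 once x^2 >= 1 + r^2.\<close>
  define b where "b x = smooth_step (1 + r * r + (-1) * (x * x))" for x
  show "differentiable_upto k b" for k
    unfolding b_def
    by (intro differentiable_upto_compose[OF differentiable_upto_smooth_step]
          differentiable_upto_add differentiable_upto_mult differentiable_upto_const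
          differentiable_upto_ident)
  show "b x = 1" if "\<bar>x\<bar> < r" for x
    using that abs_le_square_iff[of x r]
    by (auto simp: b_def power2_eq_square intro!: smooth_step_eq_1)
  \<comment> \<open>The witness for \<open>s\<close> is 1 + |r|, whose square 1 + 2 |r| + r^2 is at
    least 1 + r^2.\<close>
  show "b x = 0" if "\<bar>x\<bar> > 1 + \<bar>r\<bar>" for x
  proof -
    have "(1 + \<bar>r\<bar>) * (1 + \<bar>r\<bar>) \<le> \<bar>x\<bar> * \<bar>x\<bar>"
      using that by (intro mult_mono) auto
    hence "1 + r * r \<le> x * x"
      by (simp add: algebra_simps)
    then show ?thesis
      by (simp add: b_def smooth_step_eq_0)
  qed
qed

section \<open>Test functions\<close>

lemma topspace_Euclidean_space_iff:
  "x \<in> topspace (Euclidean_space n) \<longleftrightarrow> (\<forall>i\<ge>n. x i = 0)"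
  by (simp add: topspace_Euclidean_space)

section \<open>Smooth products of one-variable functions\<close>

lemma continuous_map_Euclidean_space_component:
  "continuous_map (Euclidean_space n) euclideanreal (\<lambda>x. x j)"
  unfolding Euclidean_space_def
  by (intro continuous_map_from_subtopology continuous_map_product_projection) auto

lemma continuous_map_Euclidean_space_prod:
  assumes "\<And>j. continuous_on UNIV (b j)"
  shows "continuous_map (Euclidean_space n) euclideanreal (\<lambda>x. \<Prod>j<n. b j (x j))"
proof (rule continuous_map_prod)
  fix j
  have "continuous_map euclideanreal euclideanreal (b j)"
    using assms by simp
  from continuous_map_compose[OF continuous_map_Euclidean_space_component this]
  show "continuous_map (Euclidean_space n) euclideanreal (\<lambda>x. b j (x j))"
    by (simp add: o_def)
qed auto

lemma continuous_on_differentiable_upto: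
  assumes "differentiable_upto (Suc k) f"
  shows "continuous_on UNIV f"
  using differentiable_upto_SucD(1)[OF assms]
  by (intro continuous_at_imp_continuous_on ballI DERIV_isCont) auto

lemma has_real_derivative_prod_update:
  fixes b :: "nat \<Rightarrow> real \<Rightarrow> real"
  assumes "i < n" "(b i has_real_derivative D) (at y)"
  shows "((\<lambda>t. \<Prod>j<n. b j ((x(i := t)) j)) has_real_derivative
           D * (\<Prod>j\<in>{..<n} - {i}. b j (x j))) (at y)"
proof -
  have "(\<Prod>j<n. b j ((x(i := t)) j)) = b i t * (\<Prod>j\<in>{..<n} - {i}. b j (x j))" for t
    using assms(1) by (subst prod.remove[of _ i]) (auto intro!: prod.cong)
  then show ?thesis
    using assms(2) by (auto intro!: DERIV_cmult_right)
qed

text \<open>Only the factor \<open>b i\<close> depends on coordinate \<open>i\<close>, so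
  differentiation stays within products of one-variable functions, and \<open>C_k_prod\<close> can
  iterate it.\<close>

lemma partial_deriv_prod:
  fixes b :: "nat \<Rightarrow> real \<Rightarrow> real"
  assumes "i < n" "\<And>y. b i differentiable at y"
  shows "partial_deriv i (\<lambda>x. \<Prod>j<n. b j (x j)) = (\<lambda>x. \<Prod>j<n. (b(i := deriv (b i))) j (x j))"
proof
  fix x
  have "(b i has_real_derivative deriv (b i) (x i)) (at (x i))"
    using assms(2) by (simp add: DERIV_deriv_iff_real_differentiable)
  from DERIV_imp_deriv[OF has_real_derivative_prod_update[where b = b, OF assms(1) this]]
  have "partial_deriv i (\<lambda>x. \<Prod>j<n. b j (x j)) x
      = deriv (b i) (x i) * (\<Prod>j\<in>{..<n} - {i}. b j (x j))"
    by (simp add: partial_deriv_def)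
  also have "\<dots> = (\<Prod>j<n. (b(i := deriv (b i))) j (x j))"
    using assms(1) by (subst prod.remove[of _ i]) (auto intro!: prod.cong)
  finally show "partial_deriv i (\<lambda>x. \<Prod>j<n. b j (x j)) x
      = (\<Prod>j<n. (b(i := deriv (b i))) j (x j))" .
qed

text \<open>The factors form a family indexed by the coordinate because differentiation alters just
  one of them. Assuming all orders makes the hypothesis stable under replacing a factor by its
  derivative.\<close>

lemma C_k_prod:
  fixes b :: "nat \<Rightarrow> real \<Rightarrow> real"
  assumes "\<And>j k. differentiable_upto k (b j)"
  shows "C_k n k (\<lambda>x. \<Prod>j<n. b j (x j))"
  using assms
proof (induction k arbitrary: b)
  case 0
  then show ?case
    using continuous_on_differentiable_upto
    by (auto intro!: continuous_map_Euclidean_space_prod simp del: differentiable_upto.simps)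
next
  case (Suc k)
  have diff: "b i differentiable at y" for i y
    using Suc.prems[of "Suc 0" i] by simp
  have "differentiable_upto m ((b(i := deriv (b i))) j)" for i j m
    using Suc.prems[of m j] Suc.prems[of "Suc m" i] by auto
  from Suc.IH[OF this]
  have "C_k n k (partial_deriv i (\<lambda>x. \<Prod>j<n. b j (x j)))" if "i < n" for i
    using that diff by (simp only: partial_deriv_prod)
  moreover have "continuous_map (Euclidean_space n) euclideanreal (\<lambda>x. \<Prod>j<n. b j (x j))"
    using continuous_on_differentiable_upto[OF Suc.prems]
    by (rule continuous_map_Euclidean_space_prod)
  moreover have "(\<lambda>t. \<Prod>j<n. b j ((x(i := t)) j)) differentiable at (x i)" if "i < n" for x i
    using has_real_derivative_prod_update[OF that] diff[of i "x i"]
    unfolding real_differentiable_def by blast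
  ultimately show ?case by simp
qed

section \<open>Compactly supported cutoffs in several variables\<close>

lemma compactin_Euclidean_space_box:
  "compactin (Euclidean_space n) {x. (\<forall>i<n. \<bar>x i\<bar> \<le> s) \<and> (\<forall>i\<ge>n. x i = 0)}"
proof -
  \<comment> \<open>With \<open>{0}\<close> in the coordinates from \<open>n\<close> on, the box is
    a full product of compact sets, and Tychonoff's theorem applies.\<close>
  have "{x. (\<forall>i<n. \<bar>x i\<bar> \<le> s) \<and> (\<forall>i\<ge>n. x i = 0)}
      = (\<Pi>\<^sub>E i\<in>UNIV. if i < n then {-s..s} else {0})"
    by (fastforce simp: PiE_iff abs_le_iff not_less split: if_splits)
  moreover have "compactin (powertop_real UNIV) (\<Pi>\<^sub>E i\<in>UNIV. if i < n then {-s..s} else {0})"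
    by (auto simp: compactin_PiE)
  ultimately show ?thesis
    by (auto simp: Euclidean_space_def compactin_subtopology)
qed

text \<open>A product of one-variable cutoffs. The strict bounds leave each coordinate room to move,
  hence the partial derivatives vanish there as well.\<close>

lemma exists_cutoff_test_function:
  fixes r :: real
  obtains \<eta> where "\<eta> \<in> test_functions n"
    "\<And>x. (\<And>j. j < n \<Longrightarrow> \<bar>x j\<bar> < r) \<Longrightarrow> \<eta> x = 1"
    "\<And>i x. i < n \<Longrightarrow> (\<And>j. j < n \<Longrightarrow> \<bar>x j\<bar> < r) \<Longrightarrow> partial_deriv i \<eta> x = 0"
proof -
  obtain b s where b: "\<And>k. differentiable_upto k b"
    and b1: "\<And>x. \<bar>x\<bar> < r \<Longrightarrow> b x = 1" and b0: "\<And>x. \<bar>x\<bar> > s \<Longrightarrow> b x = 0"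
    using exists_smooth_cutoff[of r] by metis
  define \<eta> where "\<eta> x = (\<Prod>j<n. b (x j))" for x :: "nat \<Rightarrow> real"
  define B where "B = {x::nat \<Rightarrow> real. (\<forall>i<n. \<bar>x i\<bar> \<le> s) \<and> (\<forall>i\<ge>n. x i = 0)}"
  have B: "compactin (Euclidean_space n) B"
    unfolding B_def by (rule compactin_Euclidean_space_box)
  \<comment> \<open>Compact sets in a Hausdorff space are closed, so \<open>B\<close> contains the
    closure of the set where \<eta> is nonzero, not just that set.\<close>
  have "closedin (Euclidean_space n) B"
    using B Hausdorff_Euclidean_space by (rule compactin_imp_closedin[rotated])
  moreover have "{x \<in> topspace (Euclidean_space n). \<eta> x \<noteq> 0} \<subseteq> B"
    using b0 by (force simp: B_def \<eta>_def topspace_Euclidean_space_iff not_le)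
  ultimately have "Euclidean_space n closure_of {x \<in> topspace (Euclidean_space n). \<eta> x \<noteq> 0} \<subseteq> B"
    by (rule closure_of_minimal[rotated])
  from closed_compactin[OF B this closedin_closure_of] have "\<eta> \<in> test_functions n"
    using C_k_prod[of "\<lambda>_. b" n] b by (simp add: test_functions_def \<eta>_def[abs_def])
  moreover have one: "\<eta> x = 1" if "\<And>j. j < n \<Longrightarrow> \<bar>x j\<bar> < r" for x
    using that b1 by (simp add: \<eta>_def)
  moreover have "partial_deriv i \<eta> x = 0" if "i < n" and x: "\<And>j. j < n \<Longrightarrow> \<bar>x j\<bar> < r" for i x
  proof -
    have "((\<lambda>t. \<eta> (x(i := t))) has_real_derivative 0) (at (x i))"
    proof (rule has_field_derivative_transform_within_open[where S = "{-r<..<r}" and f = "\<lambda>_. 1"])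
      show "x i \<in> {-r<..<r}"
        using x[OF that(1)] by auto
      show "1 = \<eta> (x(i := t))" if "t \<in> {-r<..<r}" for t
        using that x by (intro one[symmetric]) auto
    qed auto
    then show ?thesis
      by (simp add: partial_deriv_def DERIV_imp_deriv)
  qed
  ultimately show ?thesis by (rule that)
qed

section \<open>Supports and partial derivatives of test functions\<close>

lemma compactin_Euclidean_space_bounded:
  assumes "compactin (Euclidean_space n) K"
  obtains r where "\<And>x j. x \<in> K \<Longrightarrow> j < n \<Longrightarrow> \<bar>x j\<bar> < (r::real)"
proof -
  have "\<exists>c. \<forall>x\<in>K. \<bar>x j\<bar> \<le> c" for j
  proof -
    have "compact ((\<lambda>x. x j) ` K)"
      using image_compactin[OF assms continuous_map_Euclidean_space_component] by simp
    then show ?thesis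
      using compact_imp_bounded by (fastforce simp: bounded_iff)
  qed
  then obtain c where c: "\<And>j x. x \<in> K \<Longrightarrow> \<bar>x j\<bar> \<le> c j" by metis
  \<comment> \<open>The sum dominates each \<open>c j\<close>, giving one radius for all
    coordinates; the added 1 makes the bound strict, as the cutoff requires.\<close>
  have "\<bar>x j\<bar> < 1 + (\<Sum>i<n. \<bar>c i\<bar>)" if "x \<in> K" "j < n" for x j
  proof -
    have "\<bar>c j\<bar> \<le> (\<Sum>i<n. \<bar>c i\<bar>)"
      using that by (intro member_le_sum) auto
    then show ?thesis
      using c[OF that(1), of j] by linarith
  qed
  then show ?thesis by (rule that)
qed

text \<open>The complement of the support is open, so \<phi> vanishes near \<open>x\<close>, in
  particular along the coordinate line through \<open>x\<close>.\<close>

lemma partial_deriv_eq_0_outside_support: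
  assumes x: "x \<in> topspace (Euclidean_space n)" and i: "i < n"
    and notin: "x \<notin> Euclidean_space n closure_of {x \<in> topspace (Euclidean_space n). \<phi> x \<noteq> 0}"
  shows "partial_deriv i \<phi> x = 0"
proof -
  obtain U where U: "openin (Euclidean_space n) U" "x \<in> U"
    and "\<not> (\<exists>y\<in>{x \<in> topspace (Euclidean_space n). \<phi> x \<noteq> 0}. y \<in> U)"
    using notin x by (auto simp: in_closure_of)
  then have 0: "\<phi> y = 0" if "y \<in> U" for y
    using that openin_subset[OF U(1)] by auto
  \<comment> \<open>As \<open>i < n\<close>, the coordinate line stays in
    \<open>Euclidean_space n\<close>, so the open set \<open>U\<close> can be pulled back to the
    parameter \<open>t\<close>.\<close>
  have upd: "continuous_map euclideanreal (Euclidean_space n) (\<lambda>t. x(i := t))"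
    unfolding Euclidean_space_def
  proof (rule continuous_map_into_subtopology)
    have "continuous_map euclideanreal euclideanreal (\<lambda>t. (x(i := t)) k)" for k
      by (cases "k = i") auto
    then show "continuous_map euclideanreal (powertop_real UNIV) (\<lambda>t. x(i := t))"
      by (auto simp: continuous_map_componentwise_UNIV)
    show "(\<lambda>t. x(i := t)) \<in> topspace euclideanreal \<rightarrow> {x. \<forall>i\<ge>n. x i = 0}"
      using x i by (auto simp: topspace_Euclidean_space_iff)
  qed
  have "((\<lambda>t. \<phi> (x(i := t))) has_real_derivative 0) (at (x i))"
  proof (rule has_field_derivative_transform_within_open[where S = "{t. x(i := t) \<in> U}"
        and f = "\<lambda>_. 0"])
    show "open {t. x(i := t) \<in> U}"
      using openin_continuous_map_preimage[OF upd U(1)] by simp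
  qed (use U 0 in auto)
  then show ?thesis
    by (simp add: partial_deriv_def DERIV_imp_deriv)
qed

text \<open>The bound combines compactness of the support with vanishing off it. Both facts serve
  the integrability of the pairing with the gradient.\<close>

lemma test_function_partial_deriv:
  assumes \<phi>: "\<phi> \<in> test_functions n" and i: "i < n"
  shows continuous_map_partial_deriv:
      "continuous_map (Euclidean_space n) euclideanreal (partial_deriv i \<phi>)"
    and partial_deriv_bounded:
      "\<exists>c. \<forall>x\<in>topspace (Euclidean_space n). \<bar>partial_deriv i \<phi> x\<bar> \<le> c"
proof -
  have "C_k n (Suc 0) \<phi>"
    using \<phi> unfolding test_functions_def by blast
  then show cont: "continuous_map (Euclidean_space n) euclideanreal (partial_deriv i \<phi>)"
    using i by simp
  define K where
    "K = Euclidean_space n closure_of {x \<in> topspace (Euclidean_space n). \<phi> x \<noteq> 0}"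
  have "compactin (Euclidean_space n) K"
    using \<phi> by (simp add: test_functions_def K_def)
  from image_compactin[OF this cont] have "bounded (partial_deriv i \<phi> ` K)"
    by (simp add: compact_imp_bounded)
  then obtain c where c: "\<And>x. x \<in> K \<Longrightarrow> \<bar>partial_deriv i \<phi> x\<bar> \<le> c"
    by (auto simp: bounded_iff)
  \<comment> \<open>The maximum covers points off the support; \<open>c\<close> may be negative if
    \<open>K\<close> is empty.\<close>
  have "\<bar>partial_deriv i \<phi> x\<bar> \<le> max c 0" if "x \<in> topspace (Euclidean_space n)" for x
    using c[of x] partial_deriv_eq_0_outside_support[OF that i, of \<phi>]
    by (cases "x \<in> K") (auto simp: K_def)
  then show "\<exists>c. \<forall>x\<in>topspace (Euclidean_space n). \<bar>partial_deriv i \<phi> x\<bar> \<le> c" by blast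
qed

section \<open>Cylindrical functions on the dual\<close>

lemma topspace_weak_star: "topspace (weak_star_topology T) = dual T"
  by (auto simp: weak_star_topology_def dual_def extensional_def PiE_def)

lemma coords_in_topspace: "coords e n u \<in> topspace (Euclidean_space n)"
  by (simp add: topspace_Euclidean_space_iff coords_def)

text \<open>Evaluation at \<open>e j\<close> is one of the projections of the product topology that
  induces the weak-star topology.\<close>

lemma continuous_map_coords:
  assumes "range e \<subseteq> topspace T"
  shows "continuous_map (weak_star_topology T) (Euclidean_space n) (coords e n)"
proof -
  have "continuous_map (weak_star_topology T) euclideanreal (\<lambda>u. coords e n u j)" for j
  proof (cases "j < n")
    case True
    have "e j \<in> topspace T" using assms by auto
    then show ?thesis
      using True unfolding weak_star_topology_def coords_def
      by (auto intro!: continuous_map_from_subtopology continuous_map_product_projection)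
  qed (simp add: coords_def)
  then show ?thesis
    unfolding Euclidean_space_def
    by (intro continuous_map_into_subtopology)
       (auto simp: continuous_map_componentwise_UNIV coords_def)
qed

lemma continuous_map_imp_borel_measurable_dual:
  assumes "continuous_map (weak_star_topology T) euclideanreal f"
  shows "f \<in> borel_measurable (borel_dual T)"
proof (rule borel_measurableI)
  fix S :: "real set" assume "open S"
  hence "openin (weak_star_topology T) {u \<in> dual T. f u \<in> S}"
    using openin_continuous_map_preimage[OF assms, of S] by (simp add: topspace_weak_star)
  moreover have "f -` S \<inter> space (borel_dual T) = {u \<in> dual T. f u \<in> S}"
    by (auto simp: space_borel_dual)
  \<comment> \<open>\<open>sigma\<close> uses its generators only when all of them are subsets of
    the space.\<close>
  moreover have "{U. openin (weak_star_topology T) U} \<subseteq> Pow (dual T)"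
    using openin_subset topspace_weak_star by blast
  ultimately show "f -` S \<inter> space (borel_dual T) \<in> sets (borel_dual T)"
    by (simp add: borel_dual_def)
qed

lemma dual_zero: "u \<in> dual T \<Longrightarrow> 0 \<in> topspace T \<Longrightarrow> u 0 = 0"
  unfolding dual_def by (metis (mono_tags, lifting) mem_Collect_eq mult_zero_left scaleR_zero_left)

text \<open>Functionals are linear only on \<open>topspace T\<close>; its being a subspace keeps the
  partial sums inside.\<close>

lemma dual_sum:
  assumes "u \<in> dual T" "subspace (topspace T)" "finite A" "\<And>j. j \<in> A \<Longrightarrow> f j \<in> topspace T"
  shows "u (\<Sum>j\<in>A. a j *\<^sub>R f j) = (\<Sum>j\<in>A. a j * u (f j))"
  using assms(3,4)
proof (induction A rule: finite_induct)
  case empty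
  then show ?case
    using assms(1,2) by (simp add: dual_zero subspace_0)
next
  case (insert k A)
  have "(\<Sum>j\<in>A. a j *\<^sub>R f j) \<in> topspace T" "a k *\<^sub>R f k \<in> topspace T"
    using insert assms(2) by (auto intro!: subspace_sum subspace_scale)
  then show ?case
    using insert assms(1) by (simp add: dual_def)
qed

lemma integrable_bounded_mult:
  fixes f g :: "'a \<Rightarrow> real"
  assumes "g \<in> borel_measurable M" "\<And>x. x \<in> space M \<Longrightarrow> \<bar>g x\<bar> \<le> c" "integrable M f"
  shows "integrable M (\<lambda>x. g x * f x)"
proof (rule Bochner_Integration.integrable_bound)
  show "integrable M (\<lambda>x. c * f x)"
    using assms(3) by simp
  show "AE x in M. norm (g x * f x) \<le> norm (c * f x)"
    using assms(2) by (intro AE_I2) (force simp: abs_mult intro!: mult_right_mono)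
qed (use assms in auto)

section \<open>Pairing with gradients, and cutoffs on the dual\<close>

context hamiltonian_setting
begin

text \<open>The gradient varies with \<open>u\<close>, whereas \<open>int\<close> concerns fixed
  vectors. Linearity of \<open>X u\<close> reduces the pairing to a finite sum of the integrable
  functions \<open>X u (e j)\<close> with bounded, weak-star continuous coefficients.\<close>

lemma integrable_pairing_gradient:
  assumes rep: "represents T e n \<phi> F" and sets: "sets \<mu> = sets (borel_dual T)"
    and X: "\<And>u. u \<in> dual T \<Longrightarrow> X u \<in> dual T"
    and int: "\<And>f. f \<in> topspace T \<Longrightarrow> integrable \<mu> (\<lambda>u. X u f)"
  shows "integrable \<mu> (\<lambda>u. X u (gradient T e F u))"
proof -
  have space: "space \<mu> = dual T"
    using sets_eq_imp_space_eq[OF sets] by (simp add: space_borel_dual)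
  have \<phi>: "\<phi> \<in> test_functions n"
    using rep by (simp add: represents_def)
  have e: "e j \<in> topspace T" for j using e_in by auto
  have "integrable \<mu> (\<lambda>u. \<Sum>j<n. partial_deriv j \<phi> (coords e n u) * X u (e j))"
  proof (rule Bochner_Integration.integrable_sum)
    fix j assume j: "j \<in> {..<n}"
    obtain c where c: "\<forall>x\<in>topspace (Euclidean_space n). \<bar>partial_deriv j \<phi> x\<bar> \<le> c"
      using partial_deriv_bounded[OF \<phi>] j by auto
    have "continuous_map (weak_star_topology T) euclideanreal
        (\<lambda>u. partial_deriv j \<phi> (coords e n u))"
      using continuous_map_compose[OF continuous_map_coords[OF e_in]
          continuous_map_partial_deriv[OF \<phi>]] j by (simp add: o_def)
    hence "(\<lambda>u. partial_deriv j \<phi> (coords e n u)) \<in> borel_measurable \<mu>"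
      using continuous_map_imp_borel_measurable_dual measurable_cong_sets[OF sets refl] by blast
    then show "integrable \<mu> (\<lambda>u. partial_deriv j \<phi> (coords e n u) * X u (e j))"
      using c coords_in_topspace int[OF e] by (intro integrable_bounded_mult) auto
  qed
  moreover have "X u (gradient T e F u) = (\<Sum>j<n. partial_deriv j \<phi> (coords e n u) * X u (e j))"
    if "u \<in> space \<mu>" for u
    using that e gradient_eq[OF rep, of u] dual_sum[OF X subspace_\<Phi>, of u "{..<n}" e]
    by (simp add: space)
  ultimately show ?thesis
    by (simp cong: Bochner_Integration.integrable_cong)
qed

text \<open>The two alternatives correspond to \<open>coords e n u\<close> lying off or in the
  support of \<phi>. In either case the bracket of \<open>F\<close> and \<open>G\<close> vanishes,
  and the factor \<open>G\<close> does not change the pairing with the gradient of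
  \<open>F\<close>.\<close>

lemma exists_cylindrical_cutoff:
  assumes "F \<in> cyl_functions T e"
  obtains G where "G \<in> cyl_functions T e"
    "\<And>u. u \<in> dual T \<Longrightarrow>
      gradient T e F u = 0 \<or> G u = 1 \<and> gradient T e G u = 0"
proof -
  obtain n \<phi> where rep: "represents T e n \<phi> F"
    using assms by (auto simp: cyl_functions_def)
  define K where
    "K = Euclidean_space n closure_of {x \<in> topspace (Euclidean_space n). \<phi> x \<noteq> 0}"
  have "compactin (Euclidean_space n) K"
    using rep by (simp add: represents_def test_functions_def K_def)
  then obtain r where r: "\<And>x j. x \<in> K \<Longrightarrow> j < n \<Longrightarrow> \<bar>x j\<bar> < r"
    using compactin_Euclidean_space_bounded by blast
  obtain \<eta> where \<eta>: "\<eta> \<in> test_functions n"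
    "\<And>x. (\<And>j. j < n \<Longrightarrow> \<bar>x j\<bar> < r) \<Longrightarrow> \<eta> x = 1"
    "\<And>i x. i < n \<Longrightarrow> (\<And>j. j < n \<Longrightarrow> \<bar>x j\<bar> < r) \<Longrightarrow> partial_deriv i \<eta> x = 0"
    using exists_cutoff_test_function[of n r] by metis
  define G where "G u = \<eta> (coords e n u)" for u
  have repG: "represents T e n \<eta> G"
    using rep \<eta>(1) by (simp add: represents_def G_def)
  have "gradient T e F u = 0 \<or> G u = 1 \<and> gradient T e G u = 0" if u: "u \<in> dual T" for u
  proof (cases "coords e n u \<in> K")
    case True
    then show ?thesis
      using \<eta>(2,3) r by (simp add: G_def gradient_eq[OF repG u])
  next
    case False
    hence "partial_deriv j \<phi> (coords e n u) = 0" if "j < n" for j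
      using that partial_deriv_eq_0_outside_support[OF coords_in_topspace] by (simp add: K_def)
    then show ?thesis
      by (simp add: gradient_eq[OF rep u])
  qed
  with repG show ?thesis
    by (intro that[of G]) (auto simp: cyl_functions_def)
qed

end

theorem proposition2p5:
  fixes T :: "'h::{real_inner, polish_space} topology"
    and \<sigma> :: "'h \<Rightarrow> 'h \<Rightarrow> real"
    and J :: "'h \<Rightarrow> 'h"
    and e :: "nat \<Rightarrow> 'h"
    and \<beta> :: real
    and X :: "('h \<Rightarrow> real) \<Rightarrow> ('h \<Rightarrow> real)"
    and \<mu> :: "('h \<Rightarrow> real) measure"
  assumes "hamiltonian_setting T \<sigma> J e"
    and "X \<in> borel_dual T \<rightarrow>\<^sub>M borel_dual T"
    and "\<beta> > 0"
    and "KMS_state T J e \<beta> X \<mu>"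
  shows "\<forall>F\<in>cyl_functions T e.
           integrable \<mu> (\<lambda>u. X u (gradient T e F u)) \<and>
           (\<integral>u. X u (gradient T e F u) \<partial>\<mu>) = 0"
proof
  fix F assume F: "F \<in> cyl_functions T e"
  interpret hamiltonian_setting T \<sigma> J e by fact
  have sets: "sets \<mu> = sets (borel_dual T)"
    and int: "\<And>f. f \<in> topspace T \<Longrightarrow> integrable \<mu> (\<lambda>u. X u f)"
    and kms: "\<And>F G. F \<in> cyl_functions T e \<Longrightarrow> G \<in> cyl_functions T e \<Longrightarrow>
      (\<integral>u. poisson_bracket T J e F G u \<partial>\<mu>) = \<beta> * (\<integral>u. X u (gradient T e F u) * G u \<partial>\<mu>)"
    using assms(4) by (auto simp: KMS_state_def)
  have space: "space \<mu> = dual T"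
    using sets_eq_imp_space_eq[OF sets] by (simp add: space_borel_dual)
  have X: "X u \<in> dual T" if "u \<in> dual T" for u
    using measurable_space[OF assms(2)] that by (simp add: space_borel_dual)
  obtain G where G: "G \<in> cyl_functions T e"
    "\<And>u. u \<in> dual T \<Longrightarrow> gradient T e F u = 0 \<or> G u = 1 \<and> gradient T e G u = 0"
    using exists_cylindrical_cutoff[OF F] by blast
  \<comment> \<open>At each point one of the two gradients is 0, and \<open>J 0 = 0\<close> by
    linearity.\<close>
  have "(\<integral>u. poisson_bracket T J e F G u \<partial>\<mu>) = (\<integral>u. 0 \<partial>\<mu>)"
    using G(2) linear_0[OF bounded_linear.linear[OF J_bounded]]
    by (intro Bochner_Integration.integral_cong) (force simp: poisson_bracket_def space)+
  \<comment> \<open>Where \<open>G u\<close> may differ from 1, the gradient of \<open>F\<close> is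
    0 and the linear functional \<open>X u\<close> sends it to 0.\<close>
  moreover have "(\<integral>u. X u (gradient T e F u) * G u \<partial>\<mu>) = (\<integral>u. X u (gradient T e F u) \<partial>\<mu>)"
    using G(2) dual_zero[OF X subspace_0[OF subspace_\<Phi>]]
    by (intro Bochner_Integration.integral_cong) (force simp: space)+
  ultimately have "(\<integral>u. X u (gradient T e F u) \<partial>\<mu>) = 0"
    using kms[OF F G(1)] \<open>\<beta> > 0\<close> by simp
  \<comment> \<open>This is a separate claim: the Bochner integral is 0 by convention for a function
    that is not integrable.\<close>
  moreover have "integrable \<mu> (\<lambda>u. X u (gradient T e F u))"
    using F integrable_pairing_gradient[OF _ sets X int] by (auto simp: cyl_functions_def)
  ultimately show "integrable \<mu> (\<lambda>u. X u (gradient T e F u)) \<and>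
      (\<integral>u. X u (gradient T e F u) \<partial>\<mu>) = 0"
    by blast
qed

end
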